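(* For every prime $p\le 13$, the Burau representation modulo $p$, $\beta_{3,p}:B_3\to\mathrm{GL}(3,\mathbb{F}_p[t,t^{-1}])$, is faithful.
   Context: $B_3=\langle \sigma_1,\sigma_2\mid \sigma_1\sigma_2\sigma_1=\sigma_2\sigma_1\sigma_2\rangle$ is the 3-strand braid group. For a prime $p$, $\beta_{3,p}:B_3\to \mathrm{GL}(3,\mathbb{F}_p[t,t^{-1}])$ is the homomorphism given by $$\sigma_1\mapsto\begin{pmatrix}1-t&t&0\\1&0&0\\0&0&1\end{pmatrix},\qquad \sigma_2\mapsto\begin{pmatrix}1&0&0\\0&1-t&t\\0&1&0\end{pmatrix}.$$ *)

theory Defs
  imports
    "HOL-Algebra.Group"
    "HOL-Analysis.Analysis"
    "HOL-Library.Poly_Mapping"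
    "Berlekamp_Zassenhaus.Finite_Field"
begin

section \<open>Groups given by a presentation\<close>

text \<open>
  A word is a list of letters \<open>(x, s)\<close>; the letter \<open>(x, True)\<close> stands for the generator
  \<open>x\<close> and \<open>(x, False)\<close> for its formal inverse. A pair \<open>(u, v)\<close> in the set \<open>R\<close> is the
  relation \<open>u = v\<close>.
\<close>

type_synonym 'g word = "('g \<times> bool) list"

inductive_set pres_rel :: "('g word \<times> 'g word) set \<Rightarrow> ('g word \<times> 'g word) set"
  for R :: "('g word \<times> 'g word) set" where
  rel: "(u, v) \<in> R \<Longrightarrow> (u, v) \<in> pres_rel R"
| cancel: "([(x, s), (x, \<not> s)], []) \<in> pres_rel R"
| refl: "(u, u) \<in> pres_rel R"
| sym: "(u, v) \<in> pres_rel R \<Longrightarrow> (v, u) \<in> pres_rel R"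
| trans: "(u, v) \<in> pres_rel R \<Longrightarrow> (v, w) \<in> pres_rel R \<Longrightarrow> (u, w) \<in> pres_rel R"
| append: "(u, v) \<in> pres_rel R \<Longrightarrow> (u', v') \<in> pres_rel R \<Longrightarrow> (u @ u', v @ v') \<in> pres_rel R"

definition word_class :: "('g word \<times> 'g word) set \<Rightarrow> 'g word \<Rightarrow> 'g word set" where
  "word_class R w = pres_rel R `` {w}"

definition presented_group :: "('g word \<times> 'g word) set \<Rightarrow> 'g word set monoid" where
  "presented_group R =
    \<lparr> carrier = UNIV // pres_rel R,
      monoid.mult = (\<lambda>A B. \<Union>a\<in>A. \<Union>b\<in>B. word_class R (a @ b)),
      one = word_class R [] \<rparr>"

definition word_value :: "('h, 'm) monoid_scheme \<Rightarrow> ('g \<Rightarrow> 'h) \<Rightarrow> 'g word \<Rightarrow> 'h" where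
  "word_value H f w =
    foldr (\<lambda>(x, s) y. (if s then f x else inv\<^bsub>H\<^esub> (f x)) \<otimes>\<^bsub>H\<^esub> y) w \<one>\<^bsub>H\<^esub>"

text \<open>
  The homomorphism out of a presented group induced by an assignment \<open>f\<close> of the generators.
  It is meaningful when \<open>f\<close> respects the relations; see \<open>presented_lift_hom\<close> below.
\<close>

definition presented_lift :: "('h, 'm) monoid_scheme \<Rightarrow> ('g \<Rightarrow> 'h) \<Rightarrow> 'g word set \<Rightarrow> 'h" where
  "presented_lift H f X = the_elem (word_value H f ` X)"

lemma equiv_pres_rel: "equiv UNIV (pres_rel R)"
proof (rule equivI)
  show "refl (pres_rel R)"
    by (rule refl_onI) (rule pres_rel.refl)
  show "sym (pres_rel R)"
    by (rule symI) (rule pres_rel.sym)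
  show "trans (pres_rel R)"
    by (rule transI) (rule pres_rel.trans)
qed simp

lemma word_class_eq_iff: "word_class R u = word_class R v \<longleftrightarrow> (u, v) \<in> pres_rel R"
  unfolding word_class_def using eq_equiv_class_iff[OF equiv_pres_rel] by simp

lemma carrier_presented_group: "carrier (presented_group R) = range (word_class R)"
  unfolding presented_group_def word_class_def quotient_def by auto

lemma one_presented_group: "\<one>\<^bsub>presented_group R\<^esub> = word_class R []"
  by (simp add: presented_group_def)

lemma mult_word_class:
  "word_class R u \<otimes>\<^bsub>presented_group R\<^esub> word_class R v = word_class R (u @ v)"
proof -
  have "word_class R (a @ b) = word_class R (u @ v)"
    if "a \<in> word_class R u" "b \<in> word_class R v" for a b
  proof -
    have "(u, a) \<in> pres_rel R" "(v, b) \<in> pres_rel R"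
      using that by (simp_all add: word_class_def)
    then show ?thesis
      unfolding word_class_eq_iff by (intro pres_rel.sym[OF pres_rel.append])
  qed
  then have "(\<Union>a\<in>word_class R u. \<Union>b\<in>word_class R v. word_class R (a @ b)) =
      (\<Union>a\<in>word_class R u. \<Union>b\<in>word_class R v. word_class R (u @ v))"
    by (intro SUP_cong HOL.refl)
  moreover have "u \<in> word_class R u" "v \<in> word_class R v"
    by (simp_all add: word_class_def pres_rel.refl)
  ultimately show ?thesis
    unfolding presented_group_def monoid.simps by (metis UN_constant empty_iff)
qed

lemma word_class_inverse:
  "(rev (map (\<lambda>(x, s). (x, \<not> s)) w) @ w, []) \<in> pres_rel R"
proof (induction w)
  case Nil
  show ?case by (simp add: pres_rel.refl)
next
  case (Cons a w)
  obtain x s where a: "a = (x, s)" by force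
  let ?v = "rev (map (\<lambda>(x, s). (x, \<not> s)) w)"
  have "([(x, \<not> s), (x, s)], []) \<in> pres_rel R"
    using pres_rel.cancel[of x "\<not> s"] by simp
  then have "(?v @ ([(x, \<not> s), (x, s)] @ w), ?v @ ([] @ w)) \<in> pres_rel R"
    by (intro pres_rel.append pres_rel.refl)
  then have "(rev (map (\<lambda>(x, s). (x, \<not> s)) (a # w)) @ a # w, ?v @ w) \<in> pres_rel R"
    by (simp add: a)
  then show ?case
    using Cons.IH by (rule pres_rel.trans)
qed

lemma group_presented_group: "group (presented_group R)" (is "group ?G")
proof (rule groupI)
  fix x y z
  assume "x \<in> carrier ?G" "y \<in> carrier ?G" "z \<in> carrier ?G"
  then obtain u v w where "x = word_class R u" "y = word_class R v" "z = word_class R w"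
    unfolding carrier_presented_group by blast
  then show "x \<otimes>\<^bsub>?G\<^esub> y \<otimes>\<^bsub>?G\<^esub> z = x \<otimes>\<^bsub>?G\<^esub> (y \<otimes>\<^bsub>?G\<^esub> z)"
    by (simp only: mult_word_class append_assoc)
next
  fix x y assume "x \<in> carrier ?G" "y \<in> carrier ?G"
  then obtain u v where "x = word_class R u" "y = word_class R v"
    unfolding carrier_presented_group by blast
  then show "x \<otimes>\<^bsub>?G\<^esub> y \<in> carrier ?G"
    by (simp only: mult_word_class carrier_presented_group rangeI)
next
  show "\<one>\<^bsub>?G\<^esub> \<in> carrier ?G"
    by (simp only: one_presented_group carrier_presented_group rangeI)
next
  fix x assume "x \<in> carrier ?G"
  then obtain w where w: "x = word_class R w"
    unfolding carrier_presented_group by blast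
  then show "\<one>\<^bsub>?G\<^esub> \<otimes>\<^bsub>?G\<^esub> x = x"
    by (simp only: one_presented_group mult_word_class append_Nil)
  define w' where "w' = rev (map (\<lambda>(x, s). (x, \<not> s)) w)"
  have "word_class R w' \<otimes>\<^bsub>?G\<^esub> x = \<one>\<^bsub>?G\<^esub>"
    unfolding w mult_word_class one_presented_group word_class_eq_iff w'_def
    by (rule word_class_inverse)
  moreover have "word_class R w' \<in> carrier ?G"
    unfolding carrier_presented_group by (rule rangeI)
  ultimately show "\<exists>y\<in>carrier ?G. y \<otimes>\<^bsub>?G\<^esub> x = \<one>\<^bsub>?G\<^esub>"
    by (rule bexI)
qed

context group
begin

lemma word_value_closed:
  assumes "range f \<subseteq> carrier G"
  shows "word_value G f w \<in> carrier G"
proof -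
  have "f x \<in> carrier G" for x using assms by auto
  then show ?thesis by (induction w) (auto simp: word_value_def)
qed

lemma word_value_append:
  assumes "range f \<subseteq> carrier G"
  shows "word_value G f (u @ v) = word_value G f u \<otimes> word_value G f v"
proof (induction u)
  case Nil
  show ?case using word_value_closed[OF assms] by (simp add: word_value_def)
next
  case (Cons a u)
  obtain x s where a: "a = (x, s)" by force
  have eq: "word_value G f (a # w) = (if s then f x else inv f x) \<otimes> word_value G f w" for w
    by (simp add: word_value_def a)
  have "f x \<in> carrier G" using assms by auto
  then show ?case
    using Cons word_value_closed[OF assms] by (simp add: eq m_assoc)
qed

lemma word_value_pres_rel:
  assumes f: "range f \<subseteq> carrier G"
    and R: "\<And>u v. (u, v) \<in> R \<Longrightarrow> word_value G f u = word_value G f v"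
    and uv: "(u, v) \<in> pres_rel R"
  shows "word_value G f u = word_value G f v"
  using uv
proof induction
  case (cancel x s)
  have "f x \<in> carrier G" using f by auto
  then show ?case by (simp add: word_value_def)
qed (simp_all add: R word_value_append[OF f])

lemma presented_lift_word_class:
  assumes f: "range f \<subseteq> carrier G"
    and R: "\<And>u v. (u, v) \<in> R \<Longrightarrow> word_value G f u = word_value G f v"
  shows "presented_lift G f (word_class R w) = word_value G f w"
proof -
  have "word_value G f ` word_class R w = {word_value G f w}"
  proof (intro equalityI subsetI)
    fix y assume "y \<in> word_value G f ` word_class R w"
    then obtain v where "(w, v) \<in> pres_rel R" "y = word_value G f v"
      by (auto simp: word_class_def)
    then show "y \<in> {word_value G f w}"
      using word_value_pres_rel[OF f R] by simp
  qed (auto simp: word_class_def intro: pres_rel.refl)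
  then show ?thesis by (simp add: presented_lift_def)
qed

lemma presented_lift_hom:
  assumes f: "range f \<subseteq> carrier G"
    and R: "\<And>u v. (u, v) \<in> R \<Longrightarrow> word_value G f u = word_value G f v"
  shows "presented_lift G f \<in> hom (presented_group R) G"
  unfolding hom_def
  by (auto simp: carrier_presented_group mult_word_class presented_lift_word_class[OF f R]
      word_value_closed[OF f] word_value_append[OF f])

end


section \<open>The braid group on three strands\<close>

datatype braid_gen = Sigma1 | Sigma2

definition braid_relations :: "(braid_gen word \<times> braid_gen word) set" where
  "braid_relations =
    {([(Sigma1, True), (Sigma2, True), (Sigma1, True)],
      [(Sigma2, True), (Sigma1, True), (Sigma2, True)])}"

definition B3 :: "braid_gen word set monoid" where
  "B3 = presented_group braid_relations"

definition braid_sigma :: "braid_gen \<Rightarrow> braid_gen word set" where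
  "braid_sigma x = word_class braid_relations [(x, True)]"


section \<open>Laurent polynomials and the general linear group\<close>

text \<open>
  The ring $R[t,t^{-1}]$ is the group ring of the integers: finitely supported coefficient
  functions with the convolution product.
\<close>

type_synonym 'a laurent = "int \<Rightarrow>\<^sub>0 'a"

definition laurent_t :: "'a::comm_ring_1 laurent" where
  "laurent_t = Poly_Mapping.single 1 1"

definition GL :: "('a::comm_ring_1 ^ 'n ^ 'n) monoid" where
  "GL = \<lparr> carrier = {A. invertible A}, monoid.mult = (**), one = mat 1 \<rparr>"

lemma group_GL: "group (GL :: ('a::comm_ring_1 ^ 'n ^ 'n) monoid)"
proof (rule groupI)
  fix A :: "'a ^ 'n ^ 'n"
  assume "A \<in> carrier GL"
  then obtain B where B: "A ** B = mat 1" "B ** A = mat 1"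
    unfolding GL_def invertible_def by auto
  then have "invertible B"
    unfolding invertible_def by blast
  with B show "\<exists>B\<in>carrier GL. B \<otimes>\<^bsub>GL\<^esub> A = \<one>\<^bsub>GL\<^esub>"
    by (intro bexI[of _ B]) (simp_all add: GL_def)
next
  fix A B :: "'a ^ 'n ^ 'n"
  assume "A \<in> carrier GL" "B \<in> carrier GL"
  then have "invertible A" "invertible B"
    by (simp_all add: GL_def)
  then have "invertible (A ** B)"
    by (rule invertible_mult)
  then show "A \<otimes>\<^bsub>GL\<^esub> B \<in> carrier GL"
    by (simp add: GL_def)
next
  have "mat 1 ** mat 1 = (mat 1 :: 'a ^ 'n ^ 'n)"
    by simp
  then have "invertible (mat 1 :: 'a ^ 'n ^ 'n)"
    unfolding invertible_def by blast
  then show "\<one>\<^bsub>GL\<^esub> \<in> carrier (GL :: ('a ^ 'n ^ 'n) monoid)"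
    by (simp add: GL_def)
qed (simp_all add: GL_def matrix_mul_assoc)


section \<open>The Burau representation of \<open>B3\<close>\<close>

fun burau_gen :: "braid_gen \<Rightarrow> 'a::comm_ring_1 laurent ^ 3 ^ 3" where
  "burau_gen Sigma1 = vector
    [vector [1 - laurent_t, laurent_t, 0],
     vector [1,             0,         0],
     vector [0,             0,         1]]"
| "burau_gen Sigma2 = vector
    [vector [1, 0,             0],
     vector [0, 1 - laurent_t, laurent_t],
     vector [0, 1,             0]]"

text \<open>
  The representation modulo a prime \<open>p\<close> is the case \<open>'a = 'p mod_ring\<close>, where
  \<open>'p :: prime_card\<close> is a type with \<open>p\<close> elements, so that \<open>'p mod_ring\<close> is the
  field of integers modulo \<open>p = CARD('p)\<close>.
\<close>

definition burau :: "braid_gen word set \<Rightarrow> 'a::comm_ring_1 laurent ^ 3 ^ 3" where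
  "burau = presented_lift GL burau_gen"

lemma invertible_burau_gen: "invertible (burau_gen x :: 'a::comm_ring_1 laurent ^ 3 ^ 3)"
proof -
  define s :: "'a laurent" where "s = Poly_Mapping.single (- 1) 1"
  have s: "laurent_t * s = 1" "s * laurent_t = 1"
    by (simp_all add: s_def laurent_t_def mult_single)
  show ?thesis
  proof (cases x)
    case Sigma1
    show ?thesis
      unfolding invertible_def Sigma1
      by (rule exI[of _ "vector [vector [0, 1, 0], vector [s, 1 - s, 0], vector [0, 0, 1]]"])
        (simp add: vec_eq_iff matrix_matrix_mult_def mat_def sum_3 forall_3 algebra_simps s)
  next
    case Sigma2
    show ?thesis
      unfolding invertible_def Sigma2
      by (rule exI[of _ "vector [vector [1, 0, 0], vector [0, 0, 1], vector [0, s, 1 - s]]"])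
        (simp add: vec_eq_iff matrix_matrix_mult_def mat_def sum_3 forall_3 algebra_simps s)
  qed
qed

lemma burau_gen_braid_relation:
  "burau_gen Sigma1 ** (burau_gen Sigma2 ** burau_gen Sigma1) =
   burau_gen Sigma2 ** (burau_gen Sigma1 ** burau_gen Sigma2)"
  by (simp add: vec_eq_iff matrix_matrix_mult_def sum_3 forall_3 algebra_simps)

lemma range_burau_gen: "range burau_gen \<subseteq> carrier GL"
  by (auto simp: GL_def invertible_burau_gen)

lemma word_value_burau_gen_relation:
  assumes "(u, v) \<in> braid_relations"
  shows "word_value GL burau_gen u = word_value GL burau_gen v"
  using assms burau_gen_braid_relation by (simp add: braid_relations_def word_value_def GL_def)

lemma burau_hom: "burau \<in> hom B3 GL"
  unfolding burau_def B3_def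
  by (rule group.presented_lift_hom[OF group_GL range_burau_gen word_value_burau_gen_relation])

lemma burau_braid_sigma: "burau (braid_sigma x) = burau_gen x"
  unfolding burau_def braid_sigma_def
  by (subst group.presented_lift_word_class[OF group_GL range_burau_gen
        word_value_burau_gen_relation])
    (simp_all add: word_value_def GL_def)

end

theory Submission
  imports Defs
begin

text \<open>
  Why the representation is faithful. The half twist \<open>a = \<sigma>\<^sub>1 \<sigma>\<^sub>2 \<sigma>\<^sub>1\<close> and the third of a twist
  \<open>d = \<sigma>\<^sub>1 \<sigma>\<^sub>2\<close> generate \<open>B3\<close> and satisfy \<open>a\<^sup>2 = d\<^sup>3\<close>; this element \<open>z\<close> is central, and modulo
  \<open>z\<close> the group is a quotient of the free product of a group of order 2 and a group of
  order 3. Hence every braid is a power of \<open>z\<close> times an alternating word in \<open>a\<close> and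
  \<open>d, d\<^sup>2\<close> (lemma \<open>B3_normal_forms\<close>). It remains to see that the Burau matrices of these normal
  forms are not the identity, except for the trivial one.

  The matrices fix the vector \<open>(1, 1, 1)\<close>, so they act on the successive differences
  \<open>(p, q) = (v\<^sub>1 - v\<^sub>2, v\<^sub>2 - v\<^sub>3)\<close> of the coordinates of a vector. There
  \<open>a (p, q) = (- t\<^sup>2 q, - t p)\<close>, \<open>d (p, q) = (- t p - t\<^sup>2 q, p)\<close>, and \<open>z\<close> is multiplication
  by \<open>t\<^sup>3\<close>. In the coordinates \<open>(p, t q)\<close> the element \<open>d\<close> is \<open>t\<close> times a constant matrix of order
  3. Reduced modulo \<open>t\<close>, it permutes three distinct lines cyclically, while \<open>a\<close> maps every
  vector off one of these lines to that line. So the orders of vanishing at \<open>t = 0\<close> give a ping-pong: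
  let \<open>X\<close> consist of the vectors for which \<open>p\<close> vanishes to no higher order than \<open>q\<close>, and \<open>Y\<close> of
  those for which \<open>q\<close> vanishes to a lower order than \<open>p\<close>. Then \<open>a\<close> maps \<open>Y\<close> to \<open>X\<close>, and \<open>d\<close> and
  \<open>d\<^sup>2\<close> map \<open>X\<close> to \<open>Y\<close> (lemmas \<open>half_twist_heavy\<close> and \<open>third_twist_heavy\<close>). Geometrically,
  the group acts on the Bruhat--Tits tree of the place \<open>t = 0\<close>: \<open>d\<close> turns three edges around a
  vertex, and \<open>a\<close> inverts one of them.

  Coefficients are never divided, and the lowest coefficients in the argument only change their
  sign, so it works over every nontrivial commutative ring (theorem \<open>burau_faithful\<close>), in particular
  over the integers modulo a prime.
\<close>

section \<open>Normal forms in groups with elements \<open>a, d\<close> such that \<open>a\<^sup>2 = d\<^sup>3\<close>\<close>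

inductive_set alternating :: "('a, 'm) monoid_scheme \<Rightarrow> 'a \<Rightarrow> 'a \<Rightarrow> 'a set"
  for G (structure) and a d where
  single: "a \<in> alternating G a d"
| step: "c \<in> alternating G a d \<Longrightarrow> i \<in> {1, 2} \<Longrightarrow> a \<otimes> (d [^] (i::nat) \<otimes> c) \<in> alternating G a d"

locale square_eq_cube = group G for G (structure) +
  fixes a d
  assumes a [simp]: "a \<in> carrier G" and d [simp]: "d \<in> carrier G"
    and square_eq_cube: "a \<otimes> a = d [^] (3::nat)"
begin

definition z where "z = a \<otimes> a"

text \<open>
  The exponents \<open>i\<close> and \<open>j\<close> are arbitrary, so that multiplication by \<open>d\<close> stays within a
  form; they are reduced modulo 3, at the price of a power of \<open>z\<close>, only when that is needed.
\<close>

definition normal_forms where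
  "normal_forms = {z [^] (k::int) \<otimes> d [^] (i::nat) | k i. True} \<union>
    {z [^] (k::int) \<otimes> (d [^] (i::nat) \<otimes> (c \<otimes> d [^] (j::nat))) | k i c j. c \<in> alternating G a d}"

lemma power_normal_forms: "z [^] (k::int) \<otimes> d [^] (i::nat) \<in> normal_forms"
  unfolding normal_forms_def by blast

lemma alternating_normal_forms:
  "c \<in> alternating G a d \<Longrightarrow>
    z [^] (k::int) \<otimes> (d [^] (i::nat) \<otimes> (c \<otimes> d [^] (j::nat))) \<in> normal_forms"
  unfolding normal_forms_def by blast

lemma normal_forms_cases:
  assumes "g \<in> normal_forms"
  obtains (power) k i where "g = z [^] (k::int) \<otimes> d [^] (i::nat)"
  | (alternating) k i c j where
      "g = z [^] (k::int) \<otimes> (d [^] (i::nat) \<otimes> (c \<otimes> d [^] (j::nat)))" "c \<in> alternating G a d"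
  using assms unfolding normal_forms_def by blast

lemma z_closed [simp]: "z \<in> carrier G"
  by (simp add: z_def)

lemma z_eq_cube: "z = d [^] (3::nat)"
  by (simp add: z_def square_eq_cube)

lemma alternating_closed: "c \<in> alternating G a d \<Longrightarrow> c \<in> carrier G"
  by (induction rule: alternating.induct) auto

lemma commutes_int_pow:
  assumes "x \<otimes> y = y \<otimes> x" "x \<in> carrier G" "y \<in> carrier G"
  shows "x \<otimes> y [^] (k::int) = y [^] k \<otimes> x"
proof -
  have nat: "x \<otimes> y [^] (n::nat) = y [^] n \<otimes> x" for n
    by (rule group_commutes_pow[OF assms(1)[symmetric] assms(3,2), symmetric])
  show ?thesis
  proof (cases "k \<ge> 0")
    case True
    then have "y [^] k = y [^] nat k" by (simp add: pow_nat)
    then show ?thesis by (simp only: nat)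
  next
    case False
    have "inv (y [^] n) \<otimes> x = x \<otimes> inv (y [^] n)" for n :: nat
    proof -
      have "x = (inv (y [^] n) \<otimes> y [^] n) \<otimes> x"
        using assms by simp
      also have "\<dots> = inv (y [^] n) \<otimes> x \<otimes> y [^] n"
        using assms by (simp only: nat m_assoc inv_closed nat_pow_closed)
      finally show ?thesis
        by (subst inv_solve_right) (simp_all only: assms m_closed inv_closed nat_pow_closed)
    qed
    moreover have "y [^] k = inv (y [^] nat (- k))" using False by (subst int_pow_def2) simp
    ultimately show ?thesis by (simp only:)
  qed
qed

lemma z_pow_commutes_a: "a \<otimes> z [^] (k::int) = z [^] k \<otimes> a"
  by (rule commutes_int_pow) (simp_all add: z_def m_assoc)

lemma z_pow_commutes_d: "d [^] (i::nat) \<otimes> z [^] (k::int) = z [^] k \<otimes> d [^] i"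
  by (rule commutes_int_pow) (simp_all add: z_eq_cube nat_pow_mult add.commute)

lemma d_pow_mod_3: "d [^] (i::nat) = z [^] int (i div 3) \<otimes> d [^] (i mod 3)"
  by (simp add: z_eq_cube int_pow_int nat_pow_pow nat_pow_mult)

lemma z_pow_mult_normal_forms:
  assumes "g \<in> normal_forms"
  shows "z [^] (k::int) \<otimes> g \<in> normal_forms"
proof -
  have "z [^] k \<otimes> (z [^] l \<otimes> x) = z [^] (k + l) \<otimes> x" if "x \<in> carrier G" for l :: int and x
    using that by (simp add: int_pow_mult m_assoc)
  note z_mult_z = this
  from assms show ?thesis
    by (rule normal_forms_cases)
      (simp_all add: alternating_closed z_mult_z power_normal_forms alternating_normal_forms)
qed

lemma d_mult_normal_forms:
  assumes "g \<in> normal_forms"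
  shows "d \<otimes> g \<in> normal_forms"
proof -
  have dz: "d \<otimes> (z [^] k \<otimes> x) = z [^] k \<otimes> (d \<otimes> x)" if "x \<in> carrier G" for k :: int and x
    using that z_pow_commutes_d[of 1 k] by (simp add: m_assoc[symmetric])
  have d_dpow_mult: "d \<otimes> (d [^] (i::nat) \<otimes> x) = d [^] (Suc i) \<otimes> x" if "x \<in> carrier G" for i x
    using that by (subst nat_pow_Suc2) (simp_all only: m_assoc d nat_pow_closed)
  have d_dpow: "d \<otimes> d [^] (i::nat) = d [^] (Suc i)" for i
    by (subst nat_pow_Suc2) (simp_all only: d)
  from assms show ?thesis
  proof (cases rule: normal_forms_cases)
    case (power k i)
    have "d \<otimes> g = z [^] k \<otimes> d [^] Suc i"
      unfolding power by (simp only: dz d_dpow nat_pow_closed d)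
    then show ?thesis by (simp only: power_normal_forms)
  next
    case (alternating k i c j)
    have "d \<otimes> g = z [^] k \<otimes> (d [^] Suc i \<otimes> (c \<otimes> d [^] j))"
      unfolding alternating(1)
      by (simp only: dz d_dpow_mult nat_pow_closed m_closed d alternating_closed[OF alternating(2)])
    then show ?thesis by (simp only: alternating_normal_forms alternating(2))
  qed
qed

text \<open>
  This is the step where a word can become shorter: when nothing but a power of \<open>z\<close> stands before the first
  \<open>a\<close>, the two letters \<open>a\<close> merge into a central factor \<open>z\<close>.
\<close>

lemma a_mult_normal_forms:
  assumes "g \<in> normal_forms"
  shows "a \<otimes> g \<in> normal_forms"
proof -
  have az: "a \<otimes> (z [^] k \<otimes> x) = z [^] k \<otimes> (a \<otimes> x)" if "x \<in> carrier G" for k :: int and x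
    using that z_pow_commutes_a[of k] by (simp add: m_assoc[symmetric])
  have core: "a \<otimes> (d [^] (r::nat) \<otimes> (c \<otimes> d [^] (j::nat))) \<in> normal_forms"
    if c: "c \<in> alternating G a d" and r: "r < 3" for r c j
  proof (cases "r = 0")
    case False
    with r have "r \<in> {1, 2}" by auto
    with c have "a \<otimes> (d [^] r \<otimes> c) \<in> alternating G a d" by (rule alternating.step)
    moreover have "a \<otimes> (d [^] r \<otimes> (c \<otimes> d [^] j)) =
        z [^] (0::int) \<otimes> (d [^] (0::nat) \<otimes> (a \<otimes> (d [^] r \<otimes> c) \<otimes> d [^] j))"
      using alternating_closed[OF c] by (simp add: m_assoc)
    ultimately show ?thesis by (simp only: alternating_normal_forms)
  next
    case True
    from c show ?thesis
    proof cases
      case single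
      have "a \<otimes> (d [^] r \<otimes> (c \<otimes> d [^] j)) = z [^] (1::int) \<otimes> d [^] j"
        using single True by (simp add: z_def m_assoc int_pow_1)
      then show ?thesis by (simp only: power_normal_forms)
    next
      case (step c' i)
      have "a \<otimes> (d [^] r \<otimes> (c \<otimes> d [^] j)) = z [^] (1::int) \<otimes> (d [^] i \<otimes> (c' \<otimes> d [^] j))"
        using step True alternating_closed[OF step(2)] by (simp add: z_def m_assoc int_pow_1)
      then show ?thesis using step(2) by (simp only: alternating_normal_forms)
    qed
  qed
  have pow: "a \<otimes> d [^] (r::nat) \<in> normal_forms" for r
  proof -
    have "z [^] (0::int) \<otimes> (d [^] (0::nat) \<otimes> (a \<otimes> d [^] r)) \<in> normal_forms"
      by (intro alternating_normal_forms alternating.single)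
    then show ?thesis by simp
  qed
  from assms show ?thesis
  proof (cases rule: normal_forms_cases)
    case (power k i)
    then show ?thesis by (simp add: az pow z_pow_mult_normal_forms)
  next
    case (alternating k i c j)
    have "a \<otimes> g = z [^] k \<otimes> (z [^] int (i div 3) \<otimes>
        (a \<otimes> (d [^] (i mod 3) \<otimes> (c \<otimes> d [^] j))))"
      using alternating_closed[OF alternating(2)]
      by (subst alternating(1), subst d_pow_mod_3) (simp add: az m_assoc)
    then show ?thesis using alternating(2) by (simp add: core z_pow_mult_normal_forms)
  qed
qed

lemma one_normal_forms: "\<one> \<in> normal_forms"
proof -
  have "\<one> = z [^] (0::int) \<otimes> d [^] (0::nat)" by simp
  then show ?thesis by (simp only: power_normal_forms)
qed

section \<open>Ping-pong\<close>

text \<open>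
  The word \<open>c\<close> in a normal form begins and ends with \<open>a\<close>, so it maps \<open>Y\<close> to \<open>X\<close>. Suppose that
  an element containing \<open>c\<close> acts trivially. A conjugation moves the outer powers of \<open>d\<close> to one
  side, so there is an exponent \<open>m\<close> such that \<open>z\<^sup>k c d\<^sup>m\<close> acts trivially. Applied to a point \<open>y\<close>
  such that \<open>y\<close> and \<open>d\<^sup>m y\<close> both lie in \<open>Y\<close>, it gives \<open>y \<in> X\<close>, a contradiction. The hypothesis
  \<open>recur\<close> provides such a \<open>y\<close>.
\<close>

lemma ping_pong:
  fixes act :: "'a \<Rightarrow> 'x \<Rightarrow> 'x"
  assumes mult: "\<And>g h x. g \<in> carrier G \<Longrightarrow> h \<in> carrier G \<Longrightarrow> act (g \<otimes> h) x = act g (act h x)"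
    and one: "\<And>x. act \<one> x = x"
    and disjoint: "X \<inter> Y = {}" and "X \<noteq> {}"
    and aY: "\<And>y. y \<in> Y \<Longrightarrow> act a y \<in> X"
    and dX: "\<And>x i. x \<in> X \<Longrightarrow> i \<in> {1, 2} \<Longrightarrow> act (d [^] (i::nat)) x \<in> Y"
    and zX: "\<And>x k. x \<in> X \<Longrightarrow> act (z [^] (k::int)) x \<in> X"
    and zY: "\<And>y k. y \<in> Y \<Longrightarrow> act (z [^] (k::int)) y \<in> Y"
    and recur: "\<And>i. i \<in> {1, 2} \<Longrightarrow> \<exists>y\<in>Y. act (d [^] (i::nat)) y \<in> Y"
    and z_free: "\<And>k::int. (\<And>x. act (z [^] k) x = x) \<Longrightarrow> k = 0"
    and g: "g \<in> normal_forms" "\<And>x. act g x = x"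
  shows "g = \<one>"
proof -
  have Y: "Y \<noteq> {}" using dX \<open>X \<noteq> {}\<close> by blast
  have alt: "act c y \<in> X" if "c \<in> alternating G a d" "y \<in> Y" for c y
    using that by induction (simp_all add: mult aY dX alternating_closed del: insert_iff)
  have rec: "\<exists>y\<in>Y. act (d [^] m) y \<in> Y" for m :: nat
  proof -
    have "\<exists>y\<in>Y. act (d [^] (m mod 3)) y \<in> Y"
    proof (cases "m mod 3 = 0")
      case True
      then show ?thesis using Y one by auto
    next
      case False
      have "m mod 3 < 3" by simp
      with False have "m mod 3 \<in> {1, 2}" by auto
      then show ?thesis by (rule recur)
    qed
    then obtain y where "y \<in> Y" "act (d [^] (m mod 3)) y \<in> Y" by blast
    moreover from this have "act (d [^] m) y \<in> Y"
      by (subst d_pow_mod_3) (simp add: mult zY)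
    ultimately show ?thesis by blast
  qed
  from g(1) show ?thesis
  proof (cases rule: normal_forms_cases)
    case pow: (power k i)
    define l where "l = k + int (i div 3)"
    have g': "g = z [^] l \<otimes> d [^] (i mod 3)"
      unfolding pow l_def by (subst d_pow_mod_3) (simp add: int_pow_mult m_assoc)
    have "i mod 3 = 0"
    proof (rule ccontr)
      assume "i mod 3 \<noteq> 0"
      moreover have "i mod 3 < 3" by simp
      ultimately have "i mod 3 \<in> {1, 2}" by auto
      moreover obtain x where "x \<in> X" using \<open>X \<noteq> {}\<close> by blast
      ultimately have "act g x \<in> Y" by (simp add: g' mult zY dX del: insert_iff)
      with g(2) \<open>x \<in> X\<close> disjoint show False by auto
    qed
    with g' have "g = z [^] l" by simp
    with z_free[of l] g(2) show ?thesis by simp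
  next
    case core: (alternating k i c j)
    note c = alternating_closed[OF core(2)]
    obtain y where y: "y \<in> Y" "act (d [^] (j + i)) y \<in> Y" using rec by blast
    \<comment> \<open>Apply the equation that \<open>g\<close> acts trivially to the vector \<open>d [^] i\<close> applied to \<open>y\<close>, then
      cancel the leading \<open>d [^] i\<close>.\<close>
    have "act (d [^] i) (act (z [^] k) (act c (act (d [^] (j + i)) y))) = act (d [^] i) y"
    proof -
      have "d [^] i \<otimes> (z [^] k \<otimes> (c \<otimes> d [^] (j + i))) = g \<otimes> d [^] i"
        using c z_pow_commutes_d[of i k]
        by (simp add: core(1) m_assoc[symmetric] nat_pow_mult[symmetric])
      then have "act (d [^] i \<otimes> (z [^] k \<otimes> (c \<otimes> d [^] (j + i)))) y = act (g \<otimes> d [^] i) y"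
        by simp
      then show ?thesis using c g(2) by (simp add: mult core(1))
    qed
    then have "act (inv (d [^] i) \<otimes> d [^] i) (act (z [^] k) (act c (act (d [^] (j + i)) y))) =
        act (inv (d [^] i) \<otimes> d [^] i) y"
      by (simp only: mult inv_closed nat_pow_closed d)
    then have "act (z [^] k) (act c (act (d [^] (j + i)) y)) = y"
      by (simp add: one)
    moreover have "act (z [^] k) (act c (act (d [^] (j + i)) y)) \<in> X"
      by (intro zX alt core y)
    ultimately show ?thesis using y disjoint by auto
  qed
qed

end

section \<open>Normal forms of braids\<close>

definition sigma1 where "sigma1 = braid_sigma Sigma1"
definition sigma2 where "sigma2 = braid_sigma Sigma2"
definition half_twist where "half_twist = sigma1 \<otimes>\<^bsub>B3\<^esub> sigma2 \<otimes>\<^bsub>B3\<^esub> sigma1"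
definition third_twist where "third_twist = sigma1 \<otimes>\<^bsub>B3\<^esub> sigma2"

interpretation B3: group B3
  unfolding B3_def by (rule group_presented_group)

lemma braid_sigma_closed [simp]: "braid_sigma x \<in> carrier B3"
  unfolding B3_def braid_sigma_def carrier_presented_group by (rule rangeI)

lemma word_class_inverse_letter:
  "word_class braid_relations [(x, False)] = inv\<^bsub>B3\<^esub> braid_sigma x"
proof (rule B3.inv_equality[symmetric])
  show "word_class braid_relations [(x, False)] \<otimes>\<^bsub>B3\<^esub> braid_sigma x = \<one>\<^bsub>B3\<^esub>"
    unfolding B3_def braid_sigma_def mult_word_class one_presented_group word_class_eq_iff
    using pres_rel.cancel[of x False] by simp
qed (simp_all add: B3_def carrier_presented_group braid_sigma_def)

lemma sigma_closed [simp]: "sigma1 \<in> carrier B3" "sigma2 \<in> carrier B3"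
  by (simp_all add: sigma1_def sigma2_def)

lemma braid_relation:
  "sigma1 \<otimes>\<^bsub>B3\<^esub> (sigma2 \<otimes>\<^bsub>B3\<^esub> sigma1) = sigma2 \<otimes>\<^bsub>B3\<^esub> (sigma1 \<otimes>\<^bsub>B3\<^esub> sigma2)"
  unfolding sigma1_def sigma2_def B3_def braid_sigma_def mult_word_class word_class_eq_iff
  by (rule pres_rel.rel) (simp add: braid_relations_def)

interpretation B3: square_eq_cube B3 half_twist third_twist
proof
  have "half_twist \<otimes>\<^bsub>B3\<^esub> half_twist =
      sigma1 \<otimes>\<^bsub>B3\<^esub> (sigma2 \<otimes>\<^bsub>B3\<^esub> (sigma1 \<otimes>\<^bsub>B3\<^esub> (sigma1 \<otimes>\<^bsub>B3\<^esub> (sigma2 \<otimes>\<^bsub>B3\<^esub> sigma1))))"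
    by (simp add: half_twist_def B3.m_assoc)
  also have "\<dots> = third_twist [^]\<^bsub>B3\<^esub> (3::nat)"
    by (subst braid_relation) (simp add: third_twist_def B3.m_assoc numeral_3_eq_3)
  finally show "half_twist \<otimes>\<^bsub>B3\<^esub> half_twist = third_twist [^]\<^bsub>B3\<^esub> (3::nat)" .
qed (simp_all add: half_twist_def third_twist_def)

text \<open>
  Each generator and each inverse is a product of \<open>a\<close>, \<open>d\<close> and \<open>z\<^sup>-\<^sup>1\<close>, for instance
  \<open>\<sigma>\<^sub>1 = d\<^sup>-\<^sup>1 a\<close> with \<open>d\<^sup>-\<^sup>1 = z\<^sup>-\<^sup>1 d\<^sup>2\<close>, so the normal forms are closed under left multiplication
  by letters.
\<close>

lemma B3_normal_forms: "carrier B3 \<subseteq> B3.normal_forms"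
proof -
  note tw = third_twist_def half_twist_def
  let ?a = half_twist and ?d = third_twist and ?Z = "B3.z [^]\<^bsub>B3\<^esub> (- 1 :: int)"
  note closed = B3.z_pow_mult_normal_forms B3.a_mult_normal_forms B3.d_mult_normal_forms
  have Z: "?Z = inv\<^bsub>B3\<^esub> (?d \<otimes>\<^bsub>B3\<^esub> (?d \<otimes>\<^bsub>B3\<^esub> ?d))" "?Z = inv\<^bsub>B3\<^esub> (?a \<otimes>\<^bsub>B3\<^esub> ?a)"
    by (simp_all add: B3.int_pow_neg B3.z_eq_cube numeral_3_eq_3 B3.m_assoc)
       (simp add: B3.z_def[symmetric] B3.z_eq_cube numeral_3_eq_3 B3.m_assoc)
  have a_eq: "?a = ?d \<otimes>\<^bsub>B3\<^esub> sigma1"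
    by (simp add: tw)
  have inv_d: "inv\<^bsub>B3\<^esub> ?d = ?Z \<otimes>\<^bsub>B3\<^esub> (?d \<otimes>\<^bsub>B3\<^esub> ?d)"
    unfolding Z(1) by (simp add: B3.inv_mult_group B3.m_assoc B3.inv_solve_left')
  have inv_a: "inv\<^bsub>B3\<^esub> ?a = ?Z \<otimes>\<^bsub>B3\<^esub> ?a"
    unfolding Z(2) by (simp add: B3.inv_mult_group B3.m_assoc)
  have inv_d_mult: "inv\<^bsub>B3\<^esub> ?d \<otimes>\<^bsub>B3\<^esub> g \<in> B3.normal_forms" if "g \<in> B3.normal_forms" "g \<in> carrier B3" for g
    using that by (simp add: inv_d B3.m_assoc closed)
  have inv_a_mult: "inv\<^bsub>B3\<^esub> ?a \<otimes>\<^bsub>B3\<^esub> g \<in> B3.normal_forms" if "g \<in> B3.normal_forms" "g \<in> carrier B3" for g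
    using that by (simp add: inv_a B3.m_assoc closed)
  have s1: "sigma1 = inv\<^bsub>B3\<^esub> ?d \<otimes>\<^bsub>B3\<^esub> ?a"
    by (simp add: a_eq B3.inv_solve_left)
  have is1: "inv\<^bsub>B3\<^esub> sigma1 = inv\<^bsub>B3\<^esub> ?a \<otimes>\<^bsub>B3\<^esub> ?d"
    by (simp add: s1 B3.inv_mult_group)
  have s2: "sigma2 = inv\<^bsub>B3\<^esub> ?a \<otimes>\<^bsub>B3\<^esub> ?d \<otimes>\<^bsub>B3\<^esub> ?d"
    unfolding is1[symmetric] by (simp add: third_twist_def B3.m_assoc[symmetric])
  have is2: "inv\<^bsub>B3\<^esub> sigma2 = inv\<^bsub>B3\<^esub> ?d \<otimes>\<^bsub>B3\<^esub> (inv\<^bsub>B3\<^esub> ?d \<otimes>\<^bsub>B3\<^esub> ?a)"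
    by (simp add: s2 B3.inv_mult_group B3.m_assoc)
  have gen: "word_class braid_relations [(x, s)] \<otimes>\<^bsub>B3\<^esub> g \<in> B3.normal_forms"
    if g: "g \<in> B3.normal_forms" "g \<in> carrier B3" for x s g
  proof -
    have "sigma1 \<otimes>\<^bsub>B3\<^esub> g \<in> B3.normal_forms" "inv\<^bsub>B3\<^esub> sigma1 \<otimes>\<^bsub>B3\<^esub> g \<in> B3.normal_forms"
      "sigma2 \<otimes>\<^bsub>B3\<^esub> g \<in> B3.normal_forms" "inv\<^bsub>B3\<^esub> sigma2 \<otimes>\<^bsub>B3\<^esub> g \<in> B3.normal_forms"
      unfolding is1 is2 unfolding s1 s2
      using g by (simp_all add: B3.m_assoc closed inv_d_mult inv_a_mult)
    then show ?thesis
      by (cases x; cases s)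
        (simp_all add: word_class_inverse_letter sigma1_def sigma2_def flip: braid_sigma_def)
  qed
  have "word_class braid_relations w \<in> B3.normal_forms" for w
  proof (induction w)
    case Nil
    show ?case using B3.one_normal_forms by (simp add: B3_def one_presented_group)
  next
    case (Cons l w)
    obtain x s where "l = (x, s)" by force
    moreover have "word_class braid_relations w \<in> carrier B3"
      by (simp add: B3_def carrier_presented_group)
    ultimately show ?case
      using gen[OF Cons, of x s] by (simp add: B3_def mult_word_class)
  qed
  then show ?thesis
    by (auto simp: B3_def carrier_presented_group)
qed

section \<open>The action on differences of coordinates\<close>

lemma lookup_laurent_t_mult [simp]:
  "Poly_Mapping.lookup (laurent_t * f) n = Poly_Mapping.lookup (f :: 'a::comm_ring_1 laurent) (n - 1)"
proof -
  have "(\<Sum>q. Poly_Mapping.lookup f q when n = 1 + q) = (\<Sum>q. Poly_Mapping.lookup f q when q = n - 1)"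
    by (rule arg_cong[of _ _ Sum_any]) (auto simp: fun_eq_iff when_def)
  then show ?thesis
    by (simp add: laurent_t_def lookup_mult lookup_single when_mult)
qed

text \<open>
  All Burau matrices fix \<open>(1, 1, 1)\<close>, hence act on the quotient by this vector, which has the
  successive differences as coordinates.
\<close>

definition differences :: "'a::comm_ring_1 laurent ^ 3 \<Rightarrow> 'a laurent \<times> 'a laurent" where
  "differences v = (v $ 1 - v $ 2, v $ 2 - v $ 3)"

definition action :: "braid_gen word set \<Rightarrow> 'a::comm_ring_1 laurent ^ 3 \<Rightarrow> 'a laurent ^ 3" where
  "action g v = burau g *v v"

lemma action_mult:
  fixes v :: "'a::comm_ring_1 laurent ^ 3"
  assumes "g \<in> carrier B3" "h \<in> carrier B3"
  shows "action (g \<otimes>\<^bsub>B3\<^esub> h) v = action g (action h v)"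
proof -
  have "burau (g \<otimes>\<^bsub>B3\<^esub> h) = (burau g ** burau h :: 'a laurent ^ 3 ^ 3)"
    using hom_mult[OF burau_hom assms] by (simp add: GL_def)
  then show ?thesis by (simp add: action_def matrix_vector_mul_assoc)
qed

lemma action_one: "action \<one>\<^bsub>B3\<^esub> v = (v :: 'a::comm_ring_1 laurent ^ 3)"
proof -
  have "burau \<one>\<^bsub>B3\<^esub> = (mat 1 :: 'a laurent ^ 3 ^ 3)"
    using hom_one[OF burau_hom B3.is_group group_GL] by (simp add: GL_def)
  then show ?thesis by (simp add: action_def)
qed

lemma differences_sigma:
  assumes "differences v = (p, q)"
  shows "differences (action sigma1 v) = (- (laurent_t * p), p + q)"
    and "differences (action sigma2 v) = (p + laurent_t * q, - (laurent_t * q))"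
  using assms
  by (auto simp: action_def sigma1_def sigma2_def burau_braid_sigma differences_def
      matrix_vector_mult_def sum_3 algebra_simps)

lemma differences_third_twist:
  assumes "differences v = (p, q)"
  shows "differences (action third_twist v) = (- (laurent_t * p) - laurent_t * (laurent_t * q), p)"
  unfolding third_twist_def
  by (simp add: action_mult differences_sigma(1)[OF differences_sigma(2)[OF assms]] algebra_simps)

lemma differences_half_twist:
  assumes "differences v = (p, q)"
  shows "differences (action half_twist v) = (- (laurent_t * (laurent_t * q)), - (laurent_t * p))"
proof -
  have *: "half_twist = third_twist \<otimes>\<^bsub>B3\<^esub> sigma1" by (simp add: half_twist_def third_twist_def)
  show ?thesis
    by (subst *)
      (simp add: action_mult differences_third_twist[OF differences_sigma(1)[OF assms]] algebra_simps)
qed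

lemma differences_surj: "\<exists>v. differences v = (p, q)"
  by (rule exI[of _ "vector [p + q, q, 0]"]) (simp add: differences_def)

lemma lookup_z_pow:
  fixes v :: "'a::comm_ring_1 laurent ^ 3" and k :: int
  defines "w \<equiv> action (B3.z [^]\<^bsub>B3\<^esub> k) v"
  shows "Poly_Mapping.lookup (fst (differences w)) n =
      Poly_Mapping.lookup (fst (differences v)) (n - 3 * k)"
    and "Poly_Mapping.lookup (snd (differences w)) n =
      Poly_Mapping.lookup (snd (differences v)) (n - 3 * k)"
proof -
  let ?f = "\<lambda>v n. (Poly_Mapping.lookup (fst (differences v)) n, Poly_Mapping.lookup (snd (differences v)) n)"
  have z: "?f (action B3.z v) n = ?f v (n - 3)" for v :: "'a laurent ^ 3" and n
  proof -
    obtain p q where pq: "differences v = (p, q)" by force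
    have "differences (action B3.z v) =
        (laurent_t * (laurent_t * (laurent_t * p)), laurent_t * (laurent_t * (laurent_t * q)))"
      using differences_half_twist[OF differences_half_twist[OF pq]]
      by (simp add: B3.z_def action_mult)
    then show ?thesis by (simp add: pq algebra_simps)
  qed
  have *: "\<forall>v n. ?f (action (B3.z [^]\<^bsub>B3\<^esub> k) v) n = ?f (v :: 'a laurent ^ 3) (n - 3 * k)" for k :: int
  proof (induction k rule: int_induct[where k = 0])
    case base
    show ?case by (simp add: action_one)
  next
    case (step1 k)
    then show ?case
      using z by (simp add: B3.int_pow_mult action_mult algebra_simps)
  next
    case (step2 k)
    have "?f (action (B3.z [^]\<^bsub>B3\<^esub> (k - 1)) v) n = ?f v (n - 3 * (k - 1))" for v :: "'a laurent ^ 3" and n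
    proof -
      have "B3.z [^]\<^bsub>B3\<^esub> k = B3.z \<otimes>\<^bsub>B3\<^esub> B3.z [^]\<^bsub>B3\<^esub> (k - 1)"
        using B3.int_pow_mult[of B3.z 1 "k - 1"] by simp
      then have "?f (action (B3.z [^]\<^bsub>B3\<^esub> k) v) (n + 3) = ?f (action (B3.z [^]\<^bsub>B3\<^esub> (k - 1)) v) n"
        using z[of "action (B3.z [^]\<^bsub>B3\<^esub> (k - 1)) v" "n + 3"] by (simp add: action_mult)
      with step2 show ?thesis by (simp add: algebra_simps)
    qed
    then show ?case by blast
  qed
  show "Poly_Mapping.lookup (fst (differences w)) n =
      Poly_Mapping.lookup (fst (differences v)) (n - 3 * k)"
    and "Poly_Mapping.lookup (snd (differences w)) n =
      Poly_Mapping.lookup (snd (differences v)) (n - 3 * k)"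
    using * unfolding w_def by simp_all
qed

section \<open>The two halves of the ping-pong\<close>

definition vanishes_below :: "int \<Rightarrow> 'a::comm_ring_1 laurent \<Rightarrow> bool" where
  "vanishes_below n f \<longleftrightarrow> (\<forall>k<n. Poly_Mapping.lookup f k = 0)"

text \<open>
  Here \<open>n\<close> is the order of vanishing at \<open>t = 0\<close> of the first, respectively the second,
  difference. In the coordinates \<open>(p, t q)\<close>, in which \<open>d\<close> is a multiple of a constant matrix,
  the two conditions say that \<open>p\<close> vanishes to a lower order than \<open>t q\<close>, and that it does not. A tie between
  \<open>p\<close> and \<open>q\<close> therefore belongs to the first set.
\<close>

definition left_heavy :: "('a::comm_ring_1 laurent ^ 3) set" where
  "left_heavy = {v. \<exists>n. Poly_Mapping.lookup (fst (differences v)) n \<noteq> 0 \<and>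
     vanishes_below n (fst (differences v)) \<and> vanishes_below n (snd (differences v))}"

definition right_heavy :: "('a::comm_ring_1 laurent ^ 3) set" where
  "right_heavy = {v. \<exists>n. Poly_Mapping.lookup (snd (differences v)) n \<noteq> 0 \<and>
     vanishes_below (n + 1) (fst (differences v)) \<and> vanishes_below n (snd (differences v))}"

lemma heavy_disjoint: "left_heavy \<inter> right_heavy = {}"
  unfolding left_heavy_def right_heavy_def vanishes_below_def
  by (auto simp: not_less) (metis linorder_not_less zless_add1_eq order_le_less)

lemma z_pow_heavy:
  fixes k :: int
  shows "v \<in> left_heavy \<Longrightarrow> action (B3.z [^]\<^bsub>B3\<^esub> k) v \<in> left_heavy"
    and "v \<in> right_heavy \<Longrightarrow> action (B3.z [^]\<^bsub>B3\<^esub> k) v \<in> right_heavy"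
proof -
  assume "v \<in> left_heavy"
  then obtain n where "Poly_Mapping.lookup (fst (differences v)) n \<noteq> 0"
    "vanishes_below n (fst (differences v))" "vanishes_below n (snd (differences v))"
    unfolding left_heavy_def by blast
  then show "action (B3.z [^]\<^bsub>B3\<^esub> k) v \<in> left_heavy"
    unfolding left_heavy_def vanishes_below_def
    by (auto simp: lookup_z_pow intro!: exI[of _ "n + 3 * k"])
next
  assume "v \<in> right_heavy"
  then obtain n where "Poly_Mapping.lookup (snd (differences v)) n \<noteq> 0"
    "vanishes_below (n + 1) (fst (differences v))" "vanishes_below n (snd (differences v))"
    unfolding right_heavy_def by blast
  then show "action (B3.z [^]\<^bsub>B3\<^esub> k) v \<in> right_heavy"
    unfolding right_heavy_def vanishes_below_def
    by (auto simp: lookup_z_pow intro!: exI[of _ "n + 3 * k"])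
qed

lemma half_twist_heavy:
  assumes "v \<in> right_heavy"
  shows "action half_twist v \<in> left_heavy"
proof -
  obtain p q where pq: "differences v = (p, q)" by force
  from assms obtain n where "Poly_Mapping.lookup q n \<noteq> 0" "vanishes_below (n + 1) p" "vanishes_below n q"
    unfolding right_heavy_def by (auto simp: pq)
  then show ?thesis
    unfolding left_heavy_def vanishes_below_def
    by (auto simp: differences_half_twist[OF pq] intro!: exI[of _ "n + 2"])
qed

lemma differences_third_twist_square:
  assumes "differences v = (p, q)"
  shows "differences (action (third_twist [^]\<^bsub>B3\<^esub> (2::nat)) v) =
    (laurent_t * (laurent_t * (laurent_t * q)), - (laurent_t * p) - laurent_t * (laurent_t * q))"
  using differences_third_twist[OF differences_third_twist[OF assms]]
  by (simp add: numeral_2_eq_2 action_mult algebra_simps)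

text \<open>
  For \<open>d\<^sup>2\<close> the second difference becomes \<open>- t p - t\<^sup>2 q\<close>; as \<open>t q\<close> vanishes to a higher
  order than \<open>p\<close>, no cancellation can affect the lowest coefficient of \<open>t p\<close>.
\<close>

lemma third_twist_heavy:
  assumes v: "v \<in> left_heavy" and i: "i \<in> {1, 2}"
  shows "action (third_twist [^]\<^bsub>B3\<^esub> (i::nat)) v \<in> right_heavy"
proof -
  obtain p q where pq: "differences v = (p, q)" by force
  from v obtain n where n: "Poly_Mapping.lookup p n \<noteq> 0" "vanishes_below n p" "vanishes_below n q"
    unfolding left_heavy_def by (auto simp: pq)
  from i consider "i = 1" | "i = 2" by auto
  then show ?thesis
  proof cases
    case 1
    with n show ?thesis
      unfolding right_heavy_def vanishes_below_def
      by (auto simp: differences_third_twist[OF pq] lookup_minus intro!: exI[of _ n])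
  next
    case 2
    with n show ?thesis
      unfolding right_heavy_def vanishes_below_def
      by (auto simp: differences_third_twist_square[OF pq] lookup_minus intro!: exI[of _ "n + 1"])
  qed
qed

text \<open>
  The witnesses come from the lines modulo \<open>t\<close>: in the coordinates \<open>(p, t q)\<close>, up to powers of \<open>t\<close>
  and signs, \<open>d\<close> sends \<open>(1, 0)\<close> to \<open>(1, -1)\<close>, this to \<open>(0, 1)\<close>, and this back to
  \<open>(1, 0)\<close>. The set \<open>right_heavy\<close> consists of the vectors off the line of
  \<open>(1, 0)\<close>, so \<open>(1, -1)\<close> serves for \<open>d\<close> and \<open>(0, 1)\<close> for \<open>d\<^sup>2\<close>.
\<close>

lemma third_twist_recurrent:
  assumes i: "i \<in> {1, 2}"
  shows "\<exists>v\<in>right_heavy. action (third_twist [^]\<^bsub>B3\<^esub> (i::nat)) (v :: 'a::comm_ring_1 laurent ^ 3) \<in> right_heavy"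
proof -
  from i consider "i = 1" | "i = 2" by auto
  then show ?thesis
  proof cases
    case 1
    obtain v :: "'a laurent ^ 3" where v: "differences v = (- laurent_t, 1)"
      using differences_surj by blast
    have "v \<in> right_heavy" "action third_twist v \<in> right_heavy"
      unfolding right_heavy_def vanishes_below_def
      by (auto simp: v differences_third_twist[OF v] laurent_t_def mult_single lookup_single lookup_one
          lookup_minus when_def intro!: exI[of _ 0] exI[of _ 1])
    with 1 show ?thesis by auto
  next
    case 2
    obtain v :: "'a laurent ^ 3" where v: "differences v = (0, 1)"
      using differences_surj by blast
    have "v \<in> right_heavy"
      unfolding right_heavy_def vanishes_below_def
      by (auto simp: v lookup_one when_def intro!: exI[of _ 0])
    moreover have "action (third_twist [^]\<^bsub>B3\<^esub> (2::nat)) v \<in> right_heavy"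
      unfolding right_heavy_def vanishes_below_def
      by (auto simp: differences_third_twist_square[OF v] laurent_t_def mult_single lookup_single
          lookup_minus when_def intro!: exI[of _ 2])
    ultimately show ?thesis using 2 by auto
  qed
qed

lemma z_pow_free:
  assumes "\<And>v :: 'a::comm_ring_1 laurent ^ 3. action (B3.z [^]\<^bsub>B3\<^esub> (k::int)) v = v"
  shows "k = 0"
proof -
  obtain v :: "'a laurent ^ 3" where v: "differences v = (1, 0)"
    using differences_surj by blast
  then show ?thesis
    using lookup_z_pow(1)[of k v 0] assms[of v] by (simp add: lookup_one when_def split: if_splits)
qed

section \<open>Faithfulness\<close>

theorem burau_faithful: "(burau :: braid_gen word set \<Rightarrow> 'a::comm_ring_1 laurent ^ 3 ^ 3) \<in> mon B3 GL"
proof -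
  have "g = \<one>\<^bsub>B3\<^esub>"
    if g: "g \<in> carrier B3" "(burau g :: 'a laurent ^ 3 ^ 3) = \<one>\<^bsub>GL\<^esub>" for g
  proof (rule B3.ping_pong[where act = "action :: _ \<Rightarrow> 'a laurent ^ 3 \<Rightarrow> _"
        and X = left_heavy and Y = right_heavy])
    obtain v :: "'a laurent ^ 3" where v: "differences v = (1, 0)"
      using differences_surj by blast
    then have "v \<in> left_heavy"
      by (auto simp: left_heavy_def vanishes_below_def lookup_one when_def intro!: exI[of _ 0])
    then show "(left_heavy :: ('a laurent ^ 3) set) \<noteq> {}" by blast
    show "g \<in> B3.normal_forms" using g(1) B3_normal_forms by blast
    show "action g v = v" for v :: "'a laurent ^ 3"
      using g(2) by (simp add: action_def GL_def)
  qed (fact action_mult action_one heavy_disjoint half_twist_heavy third_twist_heavy z_pow_heavy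
      third_twist_recurrent z_pow_free)+
  then have "inj_on (burau :: _ \<Rightarrow> 'a laurent ^ 3 ^ 3) (carrier B3)"
    using inj_on_one_iff'[OF burau_hom B3.is_group group_GL] by blast
  then show ?thesis
    using burau_hom by (simp add: mon_def)
qed

theorem theorem5p18:
  assumes "CARD('p::prime_card) \<le> 13"
  shows "(burau :: braid_gen word set \<Rightarrow> 'p mod_ring laurent ^ 3 ^ 3) \<in> mon B3 GL"
  by (rule burau_faithful)

end
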